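(* For any $(m,r)$ and $(m',r')$ in $\mathcal R$ and all $s\in[0,1]$, $$\psi_{m',r'}(\psi_{m,r}(s))=\psi_{(m,r)\ast(m',r')}(s).$$
   Context: $\mathcal R=\{(m,r)\in\mathbb R^2: r\ge 0,\ 0<m\le r+1\}$. For $(m,r)\in\mathcal R$, $\psi_{m,r}(s)=1-m\frac{1-s}{1+r(1-s)}$, $s\in[0,1]$ (a probability generating function). The binary operation $\ast$ on $\mathcal R$ is $(m,r)\ast(m',r')=(mm',\,r+r'm)$. *)

theory Defs
  imports Complex_Main
begin

definition params :: "(real \<times> real) set" where
  "params = {(m, r). r \<ge> 0 \<and> 0 < m \<and> m \<le> r + 1}"

text \<open>\<open>\<psi>\<close> is total on the reals, but it is only meaningful for parameters in \<^const>\<open>params\<close> and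
  \<open>s \<in> {0..1}\<close>, where the denominator is at least 1.\<close>

definition psi :: "real \<times> real \<Rightarrow> real \<Rightarrow> real" (\<open>\<psi>\<close>) where
  "\<psi> = (\<lambda>(m, r) s. 1 - m * ((1 - s) / (1 + r * (1 - s))))"

definition params_mult :: "real \<times> real \<Rightarrow> real \<times> real \<Rightarrow> real \<times> real" (infixl \<open>\<star>\<close> 70) where
  "p \<star> q = (case p of (m, r) \<Rightarrow> case q of (m', r') \<Rightarrow> (m * m', r + r' * m))"

text \<open>The operation is indeed one on \<^const>\<open>params\<close>, and each \<open>\<psi>\<close> is a self-map of the unit
  interval, so that the compositions make sense.\<close>

lemma params_mult_closed:
  assumes "p \<in> params" "q \<in> params"
  shows "p \<star> q \<in> params"
proof -
  obtain m r m' r' where pq: "p = (m, r)" "q = (m', r')"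
    by (metis surj_pair)
  have *: "r \<ge> 0" "0 < m" "m \<le> r + 1" "r' \<ge> 0" "0 < m'" "m' \<le> r' + 1"
    using assms by (auto simp: pq params_def)
  have "m * m' \<le> m * (r' + 1)"
    using * by (intro mult_left_mono) auto
  also have "\<dots> \<le> r + r' * m + 1"
    using * by (simp add: algebra_simps)
  finally show ?thesis
    using * by (simp add: pq params_def params_mult_def)
qed

lemma psi_in_unit_interval:
  assumes "p \<in> params" "s \<in> {0..1}"
  shows "\<psi> p s \<in> {0..1}"
proof -
  obtain m r where p: "p = (m, r)"
    by (metis surj_pair)
  have *: "r \<ge> 0" "0 < m" "m \<le> r + 1" "0 \<le> s" "s \<le> 1"
    using assms by (auto simp: p params_def)
  have pos: "1 + r * (1 - s) > 0"
    using * by (simp add: add_pos_nonneg)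
  have "m * (1 - s) \<le> (r + 1) * (1 - s)"
    using * by (intro mult_right_mono) auto
  also have "\<dots> \<le> 1 + r * (1 - s)"
    using * by (simp add: algebra_simps)
  finally have "m * (1 - s) / (1 + r * (1 - s)) \<le> 1"
    using pos by simp
  moreover have "0 \<le> m * (1 - s) / (1 + r * (1 - s))"
    using * pos by simp
  ultimately show ?thesis
    by (simp add: p psi_def)
qed

end

theory Submission
  imports Defs
begin

text \<open>In the coordinate \<open>x = 1 - s\<close> the map \<open>\<psi> (m, r)\<close> is the fractional linear map
  \<open>x \<mapsto> m * x / (1 + r * x)\<close> fixing \<open>0\<close>. In the further coordinate \<open>1 / x\<close> it is the affine map
  \<open>y \<mapsto> (y + r) / m\<close>, and composing two of these gives
  \<open>((y + r) / m + r') / m' = (y + (r + r' * m)) / (m * m')\<close>: this is where the operation \<open>\<star>\<close>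
  comes from. The proof stays in the coordinate \<open>x\<close>, since \<open>1 / x\<close> is degenerate at \<open>s = 1\<close>.\<close>

theorem proposition2p2:
  fixes m r m' r' s :: real
  assumes "(m, r) \<in> params" and "(m', r') \<in> params" and "s \<in> {0..1}"
  shows "\<psi> (m', r') (\<psi> (m, r) s) = \<psi> ((m, r) \<star> (m', r')) s"
proof -
  define x where "x = 1 - s"
  define D where "D = 1 + r * x"
  define E where "E = 1 + (r + r' * m) * x"
  have nonneg: "0 \<le> r" "0 \<le> x"
    using assms by (auto simp: params_def x_def)
  have D: "D \<noteq> 0"
    using nonneg by (smt (verit) D_def mult_nonneg_nonneg)
  have inner: "1 - \<psi> (m, r) s = m * x / D"
    by (simp add: psi_def x_def D_def)
  \<comment> \<open>The outer denominator, cleared of \<open>D\<close>, is the denominator of the product parameters.\<close>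
  have "1 + r' * (m * x / D) = E / D"
    using D by (simp add: field_simps) (simp add: D_def E_def algebra_simps)
  then have "\<psi> (m', r') (\<psi> (m, r) s) = 1 - m' * ((m * x / D) / (E / D))"
    using inner by (simp add: psi_def)
  also have "\<dots> = 1 - (m * m') * (x / E)"
    using D by simp
  also have "\<dots> = \<psi> ((m, r) \<star> (m', r')) s"
    by (simp add: psi_def params_mult_def x_def E_def)
  finally show ?thesis .
qed

end
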